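(* Let $f:\mathbb{R}^n\to\mathbb{R}$ be locally Lipschitz and let the level set $\mathcal L(\mathbf{x}_0)=\{\mathbf{x}\in\mathbb{R}^n:f(\mathbf{x})\le f(\mathbf{x}_0)\}$ be bounded. Consider the algorithm DG-MatCSG described in the context, started from $\mathbf{x}_0$ with tolerance $\delta>0$ and angle parameter $\varrho\in(0,1)$. Suppose that the line-search directions satisfy $\|\mathbf{d}_k\|=1$, that every successful step returned by the line search DG-TPLiS has step size $t_k\ge\underline t>0$, and that at every successful iteration ($I_k=1$) $$\hat{\mathbf{v}}_k^\top\mathbf{d}_k\le-\varrho\|\hat{\mathbf{v}}_k\|\,\|\mathbf{d}_k\|.$$ Assume further that after finitely many successful iterations, whenever the base point remains fixed and only enrichment iterations ($I_k=0$) occur, the search direction is reused; denote this fixed direction by $\bar{\mathbf{d}}$. Suppose that $\|\bar{\mathbf{d}}\|=1$ and that the bounded angle condition is preserved along the enrichment sequence, namely $$\hat{\mathbf{v}}_k^\top\bar{\mathbf{d}}\le-\varrho\|\hat{\mathbf{v}}_k\|\,\|\bar{\mathbf{d}}\|$$ for all $k$ during consecutive enrichment iterations at the fixed base point. Then DG-MatCSG terminates in a finite number of iterations.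
   Context: Discrete gradients. Let $D=\{\mathbf{d}\in\mathbb{R}^n:\|\mathbf{d}\|=1\}$, $G=\{\mathbf{e}\in\mathbb{R}^n:|e_j|=1,\ j=1,\dots,n\}$, and let $P$ be the set of functions $z:(0,\infty)\to(0,\infty)$ with $z(\lambda)/\lambda\to0$ as $\lambda\to0^+$. For $\mathbf{x}\in\mathbb{R}^n$, $\mathbf{d}\in D$, $\mathbf{e}\in G$, $z\in P$, $\lambda>0$, $\omega\in(0,1]$, let $i_{\max}$ be an index $j$ maximizing $|d_j|$, and put $\mathbf{x}^{(0)}=\mathbf{x}+\lambda\mathbf{d}$ and $\mathbf{x}^{(j)}=\mathbf{x}^{(0)}+z(\lambda)(\omega e_1,\dots,\omega^je_j,0,\dots,0)^\top$, $j=1,\dots,n$. The discrete gradient $\mathbf{g}(\mathbf{x},\mathbf{d},\mathbf{e},z,\lambda,\omega)\in\mathbb{R}^n$ (a "discrete gradient at $\mathbf{x}$") has components $g_j=\dfrac{f(\mathbf{x}^{(j)})-f(\mathbf{x}^{(j-1)})}{z(\lambda)\omega^je_j}$ for $j\ne i_{\max}$, and $g_{i_{\max}}=\dfrac{f(\mathbf{x}+\lambda\mathbf{d})-f(\mathbf{x})-\lambda\sum_{j\ne i_{\max}}g_jd_j}{\lambda d_{i_{\max}}}$. Line search DG-TPLiS. Input: $\varepsilon\in(0,1)$, point $\mathbf{x}$, base vector $\mathbf{v}$, unit direction $\mathbf{d}$ with $\mathbf{v}^\top\mathbf{d}<0$, parameters $0<\mu_1<\mu_2<1$, $\zeta\in(0,\tfrac12)$,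 $\underline t\in(0,\varepsilon)$, $p\in\mathbb{N}$ ($p\ge1$), and discrete-gradient parameters $\mathbf{e},z,\lambda,\omega$. Choose $t_0\in(\underline t,\varepsilon)$ and $\mathbf{d}^{(1)}\in D$, set $\mathbf{g}_0=\mathbf{g}(\mathbf{x}+t_0\mathbf{d},\mathbf{d}^{(1)},\mathbf{e},z,\lambda,\omega)$, $\bar t_0=1$, $t_0^l=0$, $t_0^u=\varepsilon$. For $i=0,1,\dots$ do in order: (1) if $f(\mathbf{x}+t_i\mathbf{d})-f(\mathbf{x})\le\mu_1t_i\mathbf{v}^\top\mathbf{d}$, set $t_{i+1}^l=t_i$, $t_{i+1}^u=t_i^u$; otherwise $t_{i+1}^l=t_i^l$, $t_{i+1}^u=t_i$; (2) if $f(\mathbf{x}+\bar t_i\mathbf{d})-f(\mathbf{x})\le\mu_1\bar t_i\mathbf{v}^\top\mathbf{d}$ and $\bar t_i\ge\underline t$, return $(\mathfrak{s},I)=(\mathbf{x}+\bar t_i\mathbf{d},1)$ (a successful step, with step size $\bar t_i$); (3) if $\mathbf{g}_i^\top\mathbf{d}\ge\mu_2\mathbf{v}^\top\mathbf{d}$, return $(\mathfrak{s},I)=(\mathbf{g}_i,0)$; (4) set $t_{i+1}=\sqrt{(t_{i+1}^l+\zeta(t_{i+1}^u-t_{i+1}^l))(t_{i+1}^u-\zeta(t_{i+1}^u-t_{i+1}^l))}$, $\bar t_{i+1}=t_0^{(i+1)/p}$, select $\mathbf{d}^{(i+1)}\in D$ and set $\mathbf{g}_{i+1}=\mathbf{g}(\mathbf{x}+t_{i+1}\mathbf{d},\mathbf{d}^{(i+1)},\mathbf{e},z,\lambda,\omega)$.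 Algorithm DG-MatCSG. Input: $\mathbf{x}_0\in\mathbb{R}^n$, $\delta>0$, $\varrho\in(0,1)$ (and fixed line-search parameters $\varepsilon,\mu_1,\mu_2,\zeta,\underline t,p$). Compute a discrete gradient $\hat{\mathbf{v}}_0$ at $\mathbf{x}_0$, set $\mathcal V(\mathbf{x}_0)=\{\hat{\mathbf{v}}_0\}$. For $k=0,1,\dots$: (a) let $\mathbf{v}_k$ be the minimal-norm element of $\operatorname{conv}(\mathcal V(\mathbf{x}_k))$; if $\|\mathbf{v}_k\|\le\delta$, return $\mathbf{x}_k$ and terminate; (b) if $k=0$ or $I_{k-1}=1$, compute the raw direction $\mathbf{d}_0^{\mathrm{MCS}}=-\mathbf{v}_0$ (for $k=0$), respectively $\mathbf{d}_k^{\mathrm{MCS}}=-\mathbf{v}_k+B_{k-1}\mathbf{d}^{\mathrm{MCS}}_{k-1}$ with a sparse matrix parameter $B_{k-1}\in\mathbb{R}^{n\times n}$ and the previous raw direction $\mathbf{d}^{\mathrm{MCS}}_{k-1}$; if it does not already satisfy $\hat{\mathbf{v}}_k^\top\mathbf{d}\le-\varrho\|\hat{\mathbf{v}}_k\|\|\mathbf{d}\|$, replace it by $\mathbf{d}-\varpi\hat{\mathbf{v}}_k$ with $\varpi=\big(\hat{\mathbf{v}}_k^\top\mathbf{d}+\varrho\sqrt{w}\big)/\|\hat{\mathbf{v}}_k\|^2$, $w=\big(\|\hat{\mathbf{v}}_k\|^2\|\mathbf{d}\|^2-(\hat{\mathbf{v}}_k^\top\mathbf{d})^2\big)/(1-\varrho^2)$;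 then normalize to obtain $\mathbf{d}_k$ with $\|\mathbf{d}_k\|=1$ and $\hat{\mathbf{v}}_k^\top\mathbf{d}_k\le-\varrho\|\hat{\mathbf{v}}_k\|$. Otherwise set $\mathbf{d}_k=\mathbf{d}_{k-1}$; (c) apply DG-TPLiS at $\mathbf{x}_k$ with base vector $\hat{\mathbf{v}}_k$ and direction $\mathbf{d}_k$ to obtain $(\mathfrak{s}_k,I_k)$ (each call is assumed to return); if $I_k=1$, let $t_k$ denote the accepted step size; (d) if $I_k=1$ (successful iteration), set $\mathbf{x}_{k+1}=\mathfrak{s}_k$, compute a discrete gradient $\hat{\mathbf{v}}_{k+1}$ at $\mathbf{x}_{k+1}$, set $\mathcal V(\mathbf{x}_{k+1})=\{\hat{\mathbf{v}}_{k+1}\}$; if $I_k=0$ (enrichment iteration), set $\mathbf{x}_{k+1}=\mathbf{x}_k$, $\mathcal V(\mathbf{x}_{k+1})=\mathcal V(\mathbf{x}_k)\cup\{\mathfrak{s}_k\}$, $\hat{\mathbf{v}}_{k+1}=\mathfrak{s}_k$. "Iterations" are the outer iterations $k$. *)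

theory Defs
  imports "HOL-Analysis.Analysis"
begin

text \<open>Spelled with \<open>vec\<close>, as the \<open>^\<close> syntax fixes the sort of the index type to \<open>finite\<close>.\<close>

type_synonym 'n rvec = "(real, 'n) vec"
type_synonym 'n rmat = "((real, 'n) vec, 'n) vec"

text \<open>
  The coordinates of \<open>real ^ 'n\<close> are numbered \<open>1, \<dots>, CARD('n)\<close> along the linear order
  of the index type.
\<close>

definition idx :: "'n::{finite,linorder} \<Rightarrow> nat"
  where "idx i = card {..i}"

definition sign_vectors :: "(real ^ 'n) set"
  where "sign_vectors = {e. \<forall>j. \<bar>e $ j\<bar> = 1}"

text \<open>Only the values on positive arguments matter; elsewhere the function is unconstrained.\<close>

definition step_functions :: "(real \<Rightarrow> real) set"
  where "step_functions =
    {z. (\<forall>lam>0. z lam > 0) \<and> ((\<lambda>lam. z lam / lam) \<longlongrightarrow> 0) (at_right 0)}"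

definition dg_point ::
    "'n rvec \<Rightarrow> 'n rvec \<Rightarrow> 'n rvec \<Rightarrow> (real \<Rightarrow> real) \<Rightarrow> real \<Rightarrow> real \<Rightarrow> nat
      \<Rightarrow> ('n::{finite,linorder}) rvec"
  where "dg_point x d e z lam om j =
    x + lam *\<^sub>R d + z lam *\<^sub>R (\<chi> i. if idx i \<le> j then om ^ idx i * e $ i else 0)"

definition dg_quotient ::
    "('n rvec \<Rightarrow> real) \<Rightarrow> 'n rvec \<Rightarrow> 'n rvec \<Rightarrow> 'n rvec \<Rightarrow> (real \<Rightarrow> real) \<Rightarrow> real \<Rightarrow> real
      \<Rightarrow> 'n::{finite,linorder} \<Rightarrow> real"
  where "dg_quotient f x d e z lam om j =
    (f (dg_point x d e z lam om (idx j)) - f (dg_point x d e z lam om (idx j - 1)))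
      / (z lam * om ^ idx j * e $ j)"

text \<open>
  A relation rather than a function, because every index \<open>m\<close> at which \<open>\<bar>d $ j\<bar>\<close> is maximal
  is an admissible choice.
\<close>

definition is_discrete_gradient ::
    "('n rvec \<Rightarrow> real) \<Rightarrow> 'n rvec \<Rightarrow> 'n rvec \<Rightarrow> 'n rvec \<Rightarrow> (real \<Rightarrow> real) \<Rightarrow> real \<Rightarrow> real
      \<Rightarrow> ('n::{finite,linorder}) rvec \<Rightarrow> bool"
  where "is_discrete_gradient f x d e z lam om g \<longleftrightarrow>
    (\<exists>m. (\<forall>j. \<bar>d $ j\<bar> \<le> \<bar>d $ m\<bar>) \<and>
         (\<forall>j. j \<noteq> m \<longrightarrow> g $ j = dg_quotient f x d e z lam om j) \<and>
         g $ m = (f (x + lam *\<^sub>R d) - f x - lam * (\<Sum>j\<in>UNIV - {m}. g $ j * d $ j))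
                   / (lam * d $ m))"

definition dg_params_ok :: "('n::finite) rvec \<Rightarrow> (real \<Rightarrow> real) \<Rightarrow> real \<Rightarrow> real \<Rightarrow> bool"
  where "dg_params_ok e z lam om \<longleftrightarrow>
    e \<in> sign_vectors \<and> z \<in> step_functions \<and> lam > 0 \<and> 0 < om \<and> om \<le> 1"

definition discrete_gradient_at ::
    "('n rvec \<Rightarrow> real) \<Rightarrow> 'n rvec \<Rightarrow> ('n::{finite,linorder}) rvec \<Rightarrow> bool"
  where "discrete_gradient_at f x g \<longleftrightarrow>
    (\<exists>d e z lam om. norm d = 1 \<and> dg_params_ok e z lam om \<and> is_discrete_gradient f x d e z lam om g)"

record ls_params =
  eps :: real
  mu1 :: real
  mu2 :: real
  zeta :: real
  tmin :: real
  pexp :: nat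

definition ls_params_ok :: "ls_params \<Rightarrow> bool"
  where "ls_params_ok P \<longleftrightarrow>
    0 < eps P \<and> eps P < 1 \<and> 0 < mu1 P \<and> mu1 P < mu2 P \<and> mu2 P < 1 \<and>
    0 < zeta P \<and> zeta P < 1 / 2 \<and> 0 < tmin P \<and> tmin P < eps P \<and> 1 \<le> pexp P"

text \<open>
  The returned pair of a vector and a flag \<open>I\<close>: \<open>Success\<close> is \<open>I = 1\<close> and also records the
  accepted step size, \<open>Enrichment\<close> is \<open>I = 0\<close>.
\<close>

datatype 'a ls_outcome =
    is_success: Success (ls_vector: 'a) (step_size: real)
  | Enrichment (ls_vector: 'a)

definition armijo ::
    "('a::real_inner \<Rightarrow> real) \<Rightarrow> ls_params \<Rightarrow> 'a \<Rightarrow> 'a \<Rightarrow> 'a \<Rightarrow> real \<Rightarrow> bool"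
  where "armijo f P x v d t \<longleftrightarrow> f (x + t *\<^sub>R d) - f x \<le> mu1 P * t * (v \<bullet> d)"

text \<open>Since \<open>t0 > 0\<close>, the value at \<open>i = 0\<close> is \<open>1\<close>.\<close>

definition tbar :: "ls_params \<Rightarrow> real \<Rightarrow> nat \<Rightarrow> real"
  where "tbar P t0 i = t0 powr (real i / real (pexp P))"

definition next_t :: "ls_params \<Rightarrow> real \<Rightarrow> real \<Rightarrow> real"
  where "next_t P l u = sqrt ((l + zeta P * (u - l)) * (u - zeta P * (u - l)))"

text \<open>
  \<open>tplis_loop \<dots> i t l u g r\<close>: the loop, entered at counter \<open>i\<close> with \<open>t\<^sub>i = t\<close>, bracket \<open>l\<close>, \<open>u\<close>
  and discrete gradient \<open>g\<close>, can return \<open>r\<close> after finitely many passes.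
\<close>

inductive tplis_loop ::
    "('n rvec \<Rightarrow> real) \<Rightarrow> ls_params \<Rightarrow> 'n rvec \<Rightarrow> 'n rvec \<Rightarrow> 'n rvec \<Rightarrow>
     'n rvec \<Rightarrow> (real \<Rightarrow> real) \<Rightarrow> real \<Rightarrow> real \<Rightarrow> real \<Rightarrow>
     nat \<Rightarrow> real \<Rightarrow> real \<Rightarrow> real \<Rightarrow> 'n rvec \<Rightarrow> ('n::{finite,linorder}) rvec ls_outcome \<Rightarrow> bool"
  for f P x v d e z lam om t0
where
  success:
    "armijo f P x v d (tbar P t0 i) \<Longrightarrow> tmin P \<le> tbar P t0 i \<Longrightarrow>
     tplis_loop f P x v d e z lam om t0 i t l u g
       (Success (x + tbar P t0 i *\<^sub>R d) (tbar P t0 i))"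
| enrich:
    "\<not> (armijo f P x v d (tbar P t0 i) \<and> tmin P \<le> tbar P t0 i) \<Longrightarrow>
     g \<bullet> d \<ge> mu2 P * (v \<bullet> d) \<Longrightarrow>
     tplis_loop f P x v d e z lam om t0 i t l u g (Enrichment g)"
| continue:
    "\<not> (armijo f P x v d (tbar P t0 i) \<and> tmin P \<le> tbar P t0 i) \<Longrightarrow>
     \<not> g \<bullet> d \<ge> mu2 P * (v \<bullet> d) \<Longrightarrow>
     l' = (if armijo f P x v d t then t else l) \<Longrightarrow>
     u' = (if armijo f P x v d t then u else t) \<Longrightarrow>
     t' = next_t P l' u' \<Longrightarrow>
     norm d' = 1 \<Longrightarrow>
     is_discrete_gradient f (x + t' *\<^sub>R d) d' e z lam om g' \<Longrightarrow>
     tplis_loop f P x v d e z lam om t0 (Suc i) t' l' u' g' r \<Longrightarrow>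
     tplis_loop f P x v d e z lam om t0 i t l u g r"

definition DG_TPLiS ::
    "('n rvec \<Rightarrow> real) \<Rightarrow> ls_params \<Rightarrow> 'n rvec \<Rightarrow> 'n rvec \<Rightarrow> 'n rvec \<Rightarrow>
     'n rvec \<Rightarrow> (real \<Rightarrow> real) \<Rightarrow> real \<Rightarrow> real \<Rightarrow>
     ('n::{finite,linorder}) rvec ls_outcome \<Rightarrow> bool"
  where "DG_TPLiS f P x v d e z lam om r \<longleftrightarrow>
    norm d = 1 \<and> v \<bullet> d < 0 \<and> dg_params_ok e z lam om \<and>
    (\<exists>t0 d1 g0. tmin P < t0 \<and> t0 < eps P \<and> norm d1 = 1 \<and>
       is_discrete_gradient f (x + t0 *\<^sub>R d) d1 e z lam om g0 \<and>
       tplis_loop f P x v d e z lam om t0 0 t0 0 (eps P) g0 r)"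

definition angle_ok :: "real \<Rightarrow> 'a::real_inner \<Rightarrow> 'a \<Rightarrow> bool"
  where "angle_ok rho v d \<longleftrightarrow> v \<bullet> d \<le> - rho * norm v * norm d"

definition angle_correct :: "real \<Rightarrow> 'a::real_inner \<Rightarrow> 'a \<Rightarrow> 'a"
  where "angle_correct rho v d =
    (if angle_ok rho v d then d
     else let w = ((norm v)\<^sup>2 * (norm d)\<^sup>2 - (v \<bullet> d)\<^sup>2) / (1 - rho\<^sup>2);
              varpi = (v \<bullet> d + rho * sqrt w) / (norm v)\<^sup>2
          in d - varpi *\<^sub>R v)"

text \<open>
  A run of the algorithm, as the sequences of all quantities it computes. Entries beyond the
  iteration at which the stopping test succeeds are meaningless and left unconstrained.
\<close>

record 'a dg_run =
  pt :: "nat \<Rightarrow> 'a"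
  dgset :: "nat \<Rightarrow> 'a set"
  vmin :: "nat \<Rightarrow> 'a"
  vhat :: "nat \<Rightarrow> 'a"
  rawdir :: "nat \<Rightarrow> 'a"
  dir :: "nat \<Rightarrow> 'a"
  outcome :: "nat \<Rightarrow> 'a ls_outcome"

definition reached :: "real \<Rightarrow> ('a::real_normed_vector) dg_run \<Rightarrow> nat \<Rightarrow> bool"
  where "reached delta R k \<longleftrightarrow> (\<forall>j<k. \<not> norm (vmin R j) \<le> delta)"

definition stops_at :: "real \<Rightarrow> ('a::real_normed_vector) dg_run \<Rightarrow> nat \<Rightarrow> bool"
  where "stops_at delta R k \<longleftrightarrow> reached delta R k \<and> norm (vmin R k) \<le> delta"

definition performed :: "real \<Rightarrow> ('a::real_normed_vector) dg_run \<Rightarrow> nat \<Rightarrow> bool"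
  where "performed delta R k \<longleftrightarrow> reached delta R k \<and> \<not> norm (vmin R k) \<le> delta"

text \<open>
  The raw direction is not recomputed in an iteration following an enrichment, so
  \<open>rawdir R (k - 1)\<close> is always the most recently computed raw direction, before angle
  correction and normalization.
\<close>

definition direction_step ::
    "real \<Rightarrow> (nat \<Rightarrow> 'n rmat) \<Rightarrow> ('n::finite) rvec dg_run \<Rightarrow> nat \<Rightarrow> bool"
  where "direction_step rho B R k \<longleftrightarrow>
    (if k = 0 \<or> is_success (outcome R (k - 1)) then
       rawdir R k =
         (if k = 0 then - vmin R 0 else - vmin R k + B (k - 1) *v rawdir R (k - 1)) \<and>
       (let d = angle_correct rho (vhat R k) (rawdir R k)
        in dir R k = (1 / norm d) *\<^sub>R d)
     else rawdir R k = rawdir R (k - 1) \<and> dir R k = dir R (k - 1))"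

definition update_step ::
    "('n rvec \<Rightarrow> real) \<Rightarrow> ('n::{finite,linorder}) rvec dg_run \<Rightarrow> nat \<Rightarrow> bool"
  where "update_step f R k \<longleftrightarrow>
    (if is_success (outcome R k) then
       pt R (Suc k) = ls_vector (outcome R k) \<and>
       discrete_gradient_at f (pt R (Suc k)) (vhat R (Suc k)) \<and>
       dgset R (Suc k) = {vhat R (Suc k)}
     else
       pt R (Suc k) = pt R k \<and>
       vhat R (Suc k) = ls_vector (outcome R k) \<and>
       dgset R (Suc k) = dgset R k \<union> {ls_vector (outcome R k)})"

text \<open>
  The parameters of the discrete gradients may differ from one line search to the next. That
  every line search returns is part of being a run.
\<close>

definition DG_MatCSG ::
    "('n rvec \<Rightarrow> real) \<Rightarrow> ls_params \<Rightarrow> real \<Rightarrow> real \<Rightarrow> (nat \<Rightarrow> 'n rmat) \<Rightarrow> 'n rvec \<Rightarrow>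
     ('n::{finite,linorder}) rvec dg_run \<Rightarrow> bool"
  where "DG_MatCSG f P delta rho B x0 R \<longleftrightarrow>
    pt R 0 = x0 \<and> discrete_gradient_at f x0 (vhat R 0) \<and> dgset R 0 = {vhat R 0} \<and>
    (\<forall>k. reached delta R k \<longrightarrow>
       is_arg_min norm (\<lambda>u. u \<in> convex hull (dgset R k)) (vmin R k)) \<and>
    (\<forall>k. performed delta R k \<longrightarrow>
       direction_step rho B R k \<and>
       (\<exists>e z lam om. DG_TPLiS f P (pt R k) (vhat R k) (dir R k) e z lam om (outcome R k)) \<and>
       update_step f R k)"

definition enrichment_phase :: "real \<Rightarrow> ('a::real_normed_vector) dg_run \<Rightarrow> nat \<Rightarrow> nat \<Rightarrow> bool"
  where "enrichment_phase delta R m m' \<longleftrightarrow>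
    m \<le> m' \<and>
    (\<forall>k\<in>{m..m'}. performed delta R k \<and> \<not> is_success (outcome R k) \<and> pt R k = pt R m)"

end

theory Submission
  imports Defs
begin

text \<open>
  Suppose a run never stops. Every vector \<open>vhat R k\<close> belongs to the bundle whose convex hull has
  \<open>vmin R k\<close> as its shortest element, so \<open>norm (vhat R k) > delta\<close> for all \<open>k\<close>. Hence the
  slope \<open>vhat R k \<bullet> dir R k\<close> is at most \<open>- rho * delta\<close> wherever the angle condition holds, that
  is, at successful iterations and in late enrichment phases.

  A successful step has length at least \<open>tmin P\<close>, so by the Armijo test it lowers \<open>f\<close> by at least
  \<open>mu1 P * tmin P * rho * delta\<close>. Enrichments leave the value of \<open>f\<close> unchanged, and \<open>f\<close>
  is bounded below since it is continuous with a compact level set; hence from some iteration on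
  all steps are enrichments. Then base point and
  direction \<open>d\<close> no longer change, and each enrichment yields a gradient with
  \<open>vhat R (Suc k) \<bullet> d \<ge> mu2 P * (vhat R k \<bullet> d)\<close>. The quantity \<open>- (vhat R k \<bullet> d)\<close> thus drops by at
  least \<open>(1 - mu2 P) * rho * delta\<close> in each iteration while it stays positive, which is absurd.

  Both halves rest on \<open>eventually_decrease_less\<close>: a decreasing sequence bounded below cannot
  drop by a fixed positive amount infinitely often.
\<close>

lemma eventually_decrease_less:
  fixes a :: "nat \<Rightarrow> real"
  assumes "\<And>k. a (Suc k) \<le> a k" and "\<And>k. L \<le> a k" and "c > 0"
  shows "\<forall>\<^sub>F k in sequentially. a k - a (Suc k) < c"
proof -
  have "decseq a" using assms(1) by (rule decseq_SucI)
  then obtain l where l: "a \<longlonglongrightarrow> l" using assms(2) by (auto intro: decseq_convergent)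
  have "(\<lambda>k. a k - a (Suc k)) \<longlonglongrightarrow> l - l"
    by (intro tendsto_diff l LIMSEQ_Suc)
  then have "(\<lambda>k. a k - a (Suc k)) \<longlonglongrightarrow> 0" by simp
  then show ?thesis using \<open>c > 0\<close> by (rule order_tendstoD(2))
qed

lemma locally_lipschitz_bounded_below_if_bounded_sublevel:
  fixes f :: "'a::euclidean_space \<Rightarrow> real"
  assumes lip: "local_lipschitz (UNIV :: real set) UNIV (\<lambda>_. f)"
    and bdd: "bounded {x. f x \<le> c}"
  shows "\<exists>L. \<forall>x. L \<le> f x"
proof -
  have cont: "continuous_on UNIV f"
    using local_lipschitz_continuous_on[OF lip, of 0] by simp
  have "closed {x. f x \<le> c}"
    using cont by (intro closed_Collect_le) auto
  then have "compact {x. f x \<le> c}" using bdd compact_eq_bounded_closed by blast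
  then have "bounded (f ` {x. f x \<le> c})"
    by (intro compact_imp_bounded compact_continuous_image continuous_on_subset[OF cont]) auto
  then obtain b where b: "\<And>x. f x \<le> c \<Longrightarrow> \<bar>f x\<bar> \<le> b"
    by (auto simp: bounded_iff)
  have "min (- b) c \<le> f x" for x using b[of x] by (cases "f x \<le> c") auto
  then show ?thesis by blast
qed

text \<open>
  Whichever pass of the loop returns, it has just evaluated the test that justifies the outcome, and
  both tests compare against the same base vector and direction in every pass.
\<close>

lemma tplis_loop_outcome:
  assumes "tplis_loop f P x v d e z lam om t0 i t l u g r"
  shows "case r of
      Success y s \<Rightarrow> y = x + s *\<^sub>R d \<and> armijo f P x v d s
    | Enrichment h \<Rightarrow> mu2 P * (v \<bullet> d) \<le> h \<bullet> d"
  using assms by induction auto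

lemma DG_TPLiS_success:
  assumes ls: "DG_TPLiS f P x v d e z lam om r" and succ: "is_success r"
  shows "f (ls_vector r) - f x \<le> mu1 P * step_size r * (v \<bullet> d)"
proof -
  obtain t0 g0 where "tplis_loop f P x v d e z lam om t0 0 t0 0 (eps P) g0 r"
    using ls unfolding DG_TPLiS_def by blast
  from tplis_loop_outcome[OF this] show ?thesis
    using succ by (cases r) (simp_all add: armijo_def)
qed

lemma DG_TPLiS_enrichment:
  assumes ls: "DG_TPLiS f P x v d e z lam om r" and enr: "\<not> is_success r"
  shows "mu2 P * (v \<bullet> d) \<le> ls_vector r \<bullet> d"
proof -
  obtain t0 g0 where "tplis_loop f P x v d e z lam om t0 0 t0 0 (eps P) g0 r"
    using ls unfolding DG_TPLiS_def by blast
  from tplis_loop_outcome[OF this] show ?thesis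
    using enr by (cases r) simp_all
qed

lemma stops_if_not_performed:
  assumes "\<not> performed delta R k"
  shows "\<exists>K. stops_at delta R K"
proof -
  have "\<exists>j. norm (vmin R j) \<le> delta"
    using assms by (auto simp: performed_def reached_def)
  then have "stops_at delta R (LEAST j. norm (vmin R j) \<le> delta)"
    unfolding stops_at_def reached_def
    using LeastI_ex[of "\<lambda>j. norm (vmin R j) \<le> delta"] not_less_Least by blast
  then show ?thesis by blast
qed

lemma vhat_in_dgset:
  assumes run: "DG_MatCSG f P delta rho B x0 R" and performed: "\<And>k. performed delta R k"
  shows "vhat R k \<in> dgset R k"
proof (cases k)
  case 0
  then show ?thesis using run by (simp add: DG_MatCSG_def)
next
  case (Suc j)
  have "update_step f R j" using run performed by (simp add: DG_MatCSG_def)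
  then show ?thesis using Suc by (auto simp: update_step_def split: if_splits)
qed

lemma norm_vhat_gt:
  assumes run: "DG_MatCSG f P delta rho B x0 R" and performed: "\<And>k. performed delta R k"
  shows "delta < norm (vhat R k)"
proof -
  have "is_arg_min norm (\<lambda>u. u \<in> convex hull (dgset R k)) (vmin R k)"
    using run performed[of k] by (auto simp: DG_MatCSG_def performed_def)
  moreover have "vhat R k \<in> convex hull (dgset R k)"
    using vhat_in_dgset[OF assms] by (rule hull_inc)
  ultimately have "norm (vmin R k) \<le> norm (vhat R k)"
    by (auto simp: is_arg_min_def not_less)
  then show ?thesis using performed[of k] by (simp add: performed_def)
qed

lemma slope_le_if_angle:
  fixes v d :: "'a::real_inner"
  assumes "v \<bullet> d \<le> - rho * norm v * norm d" and "norm d = 1" and "0 < rho" and "delta < norm v"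
  shows "v \<bullet> d \<le> - (rho * delta)"
proof -
  have "rho * delta \<le> rho * norm v" using assms by simp
  moreover have "v \<bullet> d \<le> - (rho * norm v)" using assms by simp
  ultimately show ?thesis by linarith
qed

theorem theorem3:
  fixes f :: "('n::{finite,linorder}) rvec \<Rightarrow> real"
    and x0 :: "'n rvec"
    and P :: ls_params
    and delta rho :: real
    and B :: "nat \<Rightarrow> 'n rmat"
    and R :: "'n rvec dg_run"
    and N :: nat
  assumes f_lipschitz: "local_lipschitz (UNIV :: real set) UNIV (\<lambda>_. f)"
    and level_set: "bounded {x. f x \<le> f x0}"
    and params: "ls_params_ok P" "delta > 0" "0 < rho" "rho < 1"
    and run: "DG_MatCSG f P delta rho B x0 R"
    and unit_dirs: "\<And>k. performed delta R k \<Longrightarrow> norm (dir R k) = 1"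
    and steps: "\<And>k. performed delta R k \<Longrightarrow> is_success (outcome R k) \<Longrightarrow>
      tmin P \<le> step_size (outcome R k)"
    and angle: "\<And>k. performed delta R k \<Longrightarrow> is_success (outcome R k) \<Longrightarrow>
      vhat R k \<bullet> dir R k \<le> - rho * norm (vhat R k) * norm (dir R k)"
    and enrichment: "\<And>m m'. N \<le> m \<Longrightarrow> enrichment_phase delta R m m' \<Longrightarrow>
      \<exists>dbar. norm dbar = 1 \<and>
        (\<forall>k\<in>{m..m'}. dir R k = dbar \<and>
           vhat R k \<bullet> dbar \<le> - rho * norm (vhat R k) * norm dbar)"
  shows "\<exists>K. stops_at delta R K"
proof (rule ccontr)
  assume "\<nexists>K. stops_at delta R K"
  then have performed: "performed delta R k" for k using stops_if_not_performed by blast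
  have vhat: "delta < norm (vhat R k)" for k by (rule norm_vhat_gt[OF run performed])
  have update: "update_step f R k" for k using run performed by (simp add: DG_MatCSG_def)
  have line_search:
    "\<exists>e z lam om. DG_TPLiS f P (pt R k) (vhat R k) (dir R k) e z lam om (outcome R k)" for k
    using run performed by (simp add: DG_MatCSG_def)
  have pos: "mu1 P > 0" "mu2 P < 1" "tmin P > 0"
    using params by (auto simp: ls_params_ok_def)

  let ?c = "mu1 P * tmin P * (rho * delta)"
  have c: "?c > 0" using pos params by simp
  have decrease: "f (pt R (Suc k)) \<le> f (pt R k) - ?c" if succ: "is_success (outcome R k)" for k
  proof -
    obtain e z lam om where
      "DG_TPLiS f P (pt R k) (vhat R k) (dir R k) e z lam om (outcome R k)"
      using line_search by blast
    from DG_TPLiS_success[OF this succ]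
    have "f (pt R (Suc k)) - f (pt R k)
        \<le> mu1 P * step_size (outcome R k) * (vhat R k \<bullet> dir R k)"
      using update[of k] succ by (simp add: update_step_def)
    also have "vhat R k \<bullet> dir R k \<le> - (rho * delta)"
      using slope_le_if_angle angle[OF performed succ] unit_dirs[OF performed] params vhat by blast
    then have "mu1 P * step_size (outcome R k) * (vhat R k \<bullet> dir R k)
        \<le> mu1 P * step_size (outcome R k) * - (rho * delta)"
      using steps[OF performed succ] pos by (intro mult_left_mono) auto
    also have "\<dots> \<le> - ?c"
      using steps[OF performed succ] pos params by simp
    finally show ?thesis by simp
  qed
  have stay: "pt R (Suc k) = pt R k \<and> vhat R (Suc k) = ls_vector (outcome R k)"
    if "\<not> is_success (outcome R k)" for k
    using update[of k] that by (simp add: update_step_def)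

  obtain L where L: "\<And>x. L \<le> f x"
    using locally_lipschitz_bounded_below_if_bounded_sublevel[OF f_lipschitz level_set] by blast
  have "f (pt R (Suc k)) \<le> f (pt R k)" for k
    using decrease[of k] stay[of k] c by (cases "is_success (outcome R k)") auto
  then have "\<forall>\<^sub>F k in sequentially. f (pt R k) - f (pt R (Suc k)) < ?c"
    using L c by (rule eventually_decrease_less[of "\<lambda>k. f (pt R k)"])
  then have "\<forall>\<^sub>F k in sequentially. \<not> is_success (outcome R k)"
    by eventually_elim (use decrease in force)
  then obtain M where M: "N \<le> M" "\<And>k. M \<le> k \<Longrightarrow> \<not> is_success (outcome R k)"
    unfolding eventually_sequentially by (meson max.cobounded1 max.cobounded2 order_trans)

  have same_pt: "pt R k = pt R M" if "M \<le> k" for k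
    using that by (induction rule: dec_induct) (use stay M in auto)
  have phase: "enrichment_phase delta R M m" if "M \<le> m" for m
    unfolding enrichment_phase_def
    by (intro conjI ballI that performed M(2) same_pt) simp_all

  let ?d = "dir R M"
  \<comment> \<open>Each finite phase has its own fixed direction; all of them contain the iteration \<open>M\<close>, hence
    agree.\<close>
  have fixed_dir: "dir R k = ?d \<and> vhat R k \<bullet> ?d \<le> - rho * norm (vhat R k) * norm ?d"
    if k: "M \<le> k" for k
  proof -
    obtain dbar where
      "\<forall>j\<in>{M..k}. dir R j = dbar \<and> vhat R j \<bullet> dbar \<le> - rho * norm (vhat R j) * norm dbar"
      using enrichment[OF M(1) phase[OF k]] by blast
    moreover have "M \<in> {M..k}" "k \<in> {M..k}" using k by auto
    ultimately show ?thesis by metis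
  qed
  define b where "b j = - (vhat R (M + j) \<bullet> ?d)" for j
  let ?q = "(1 - mu2 P) * (rho * delta)"
  have b_lower: "rho * delta \<le> b j" for j
    using slope_le_if_angle fixed_dir[of "M + j"] unit_dirs[OF performed] params vhat
    unfolding b_def by (metis le_add1 le_minus_iff)
  have b_drop: "b (Suc j) \<le> b j - ?q" for j
  proof -
    have enr: "\<not> is_success (outcome R (M + j))" using M by simp
    obtain e z lam om where
      "DG_TPLiS f P (pt R (M + j)) (vhat R (M + j)) (dir R (M + j)) e z lam om (outcome R (M + j))"
      using line_search by blast
    from DG_TPLiS_enrichment[OF this enr]
    have "b (Suc j) \<le> mu2 P * b j"
      using stay[OF enr] fixed_dir[of "M + j"] by (simp add: b_def)
    moreover have "?q \<le> (1 - mu2 P) * b j"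
      using b_lower pos by (intro mult_left_mono) auto
    ultimately show ?thesis by (simp add: algebra_simps)
  qed
  have q: "?q > 0" using pos params by simp
  have "b (Suc j) \<le> b j" for j using b_drop[of j] q by linarith
  then have "\<forall>\<^sub>F j in sequentially. b j - b (Suc j) < ?q"
    using b_lower q by (rule eventually_decrease_less)
  then obtain j where "b j - b (Suc j) < ?q" by (auto simp: eventually_sequentially)
  then show False using b_drop[of j] by linarith
qed

end
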